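(* Let $\mathcal{W}$ be a set of weights, let $k\ge 2$, and let $G=(V,w)$ be a coloring game with weights in $\mathcal{W}$ admitting a $k$-stable partition. Then $f(P^+)/f(P_k^-) = O(\Delta_+)$, where $\Delta_+=\max_{v\in V}|\{u : w_{uv}>0\}|$, $P^+$ is a partition maximizing $f$, and $P_k^-$ is a $k$-stable partition of minimum global utility.
   Context: A coloring game $G=(V,w)$ has a finite set of players $V$ and symmetric weights $w_{uv}=w_{vu}\in\mathcal{W}\subseteq\mathbb{Z}\cup\{-\infty\}$ ($-\infty$ means enemies). For a partition $P$ of $V$ with $X(u)$ the group of $u$, $f_u(P)=\sum_{v\in X(u)\setminus\{u\}} w_{uv}$ and $f(P)=\sum_{u}f_u(P)$. A $k$-deviation from $P$ is a set $S$ of at most $k$ players and a (possibly empty) group $X$ of $P$ such that moving all players of $S$ into $X$ strictly increases the utility of every member of $S$; $P$ is $k$-stable if no $k$-deviation exists. *)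

theory Defs
  imports "HOL-Library.Extended_Real" "HOL-Library.Disjoint_Sets"
begin

(* Weights are integers or -\<infinity>, embedded in the extended reals; the value \<infinity> never
   occurs, so sums of weights are unambiguous.  The diagonal of w is irrelevant. *)
locale coloring_game =
  fixes W :: "ereal set" and V :: "'a set" and w :: "'a \<Rightarrow> 'a \<Rightarrow> ereal"
  assumes weight_set: "W \<subseteq> insert (-\<infinity>) (range (\<lambda>i::int. ereal (of_int i)))"
    and finite_players: "finite V"
    and weight: "\<And>u v. u \<in> V \<Longrightarrow> v \<in> V \<Longrightarrow> u \<noteq> v \<Longrightarrow> w u v \<in> W"
    and symmetric: "\<And>u v. u \<in> V \<Longrightarrow> v \<in> V \<Longrightarrow> u \<noteq> v \<Longrightarrow> w u v = w v u"

definition group_of :: "'a set set \<Rightarrow> 'a \<Rightarrow> 'a set" where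
  "group_of P u = (THE X. X \<in> P \<and> u \<in> X)"

definition utility :: "('a \<Rightarrow> 'a \<Rightarrow> ereal) \<Rightarrow> 'a set set \<Rightarrow> 'a \<Rightarrow> ereal" where
  "utility w P u = (\<Sum>v \<in> group_of P u - {u}. w u v)"

(* In a quotient of global utilities, division is that of ereal: x / 0 is \<infinity> for x > 0,
   and 0 / 0 = 0. *)
definition global_utility ::
    "'a set \<Rightarrow> ('a \<Rightarrow> 'a \<Rightarrow> ereal) \<Rightarrow> 'a set set \<Rightarrow> ereal" where
  "global_utility V w P = (\<Sum>u \<in> V. utility w P u)"

(* Groups of a partition are nonempty, so the groups emptied by the move are dropped. *)
definition move :: "'a set set \<Rightarrow> 'a set \<Rightarrow> 'a set \<Rightarrow> 'a set set" where
  "move P S X = insert (X \<union> S) ((\<lambda>Y. Y - S) ` (P - {X})) - {{}}"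

(* X = {} means that S founds a new group.  S has to be nonempty, since otherwise the
   requirement on the utilities would be void and no partition would be stable. *)
definition k_deviation ::
    "'a set \<Rightarrow> ('a \<Rightarrow> 'a \<Rightarrow> ereal) \<Rightarrow> nat \<Rightarrow> 'a set set \<Rightarrow> 'a set \<Rightarrow> 'a set \<Rightarrow> bool" where
  "k_deviation V w k P S X \<longleftrightarrow>
     S \<subseteq> V \<and> S \<noteq> {} \<and> card S \<le> k \<and> X \<in> insert {} P \<and>
     (\<forall>u\<in>S. utility w P u < utility w (move P S X) u)"

definition k_stable ::
    "'a set \<Rightarrow> ('a \<Rightarrow> 'a \<Rightarrow> ereal) \<Rightarrow> nat \<Rightarrow> 'a set set \<Rightarrow> bool" where
  "k_stable V w k P \<longleftrightarrow> partition_on V P \<and> (\<nexists>S X. k_deviation V w k P S X)"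

definition max_pos_degree :: "'a set \<Rightarrow> ('a \<Rightarrow> 'a \<Rightarrow> ereal) \<Rightarrow> nat" where
  "max_pos_degree V w = Max ((\<lambda>v. card {u \<in> V - {v}. w u v > 0}) ` V)"

end

(* Two players u and v can always found a group of their own, where each of them has utility
   w u v.  So in a 2-stable partition w u v \<le> max (f u) (f v), and f \<ge> 0 since a single player
   can do the same.  Hence w u v \<le> f u + f v; summing this over all ordered pairs with positive
   weight counts each f u at most 2 \<Delta>\<^sub>+ times. *)
theory Submission
  imports Defs
begin

text \<open>The orientation \<open>w v u\<close> matches \<open>max_pos_degree\<close>, so that the
  cardinality bound is immediate; \<open>symmetric\<close> turns it where needed.\<close>

definition pos_neighbours :: "'a set \<Rightarrow> ('a \<Rightarrow> 'a \<Rightarrow> ereal) \<Rightarrow> 'a \<Rightarrow> 'a set" where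
  "pos_neighbours V w u = {v \<in> V - {u}. w v u > 0}"

lemma card_pos_neighbours_le:
  assumes "finite V" "u \<in> V"
  shows "card (pos_neighbours V w u) \<le> max_pos_degree V w"
  unfolding max_pos_degree_def pos_neighbours_def using assms by (intro Max_ge) auto

lemma group_of_eq:
  assumes "partition_on V P" "X \<in> P" "u \<in> X"
  shows "group_of P u = X"
  unfolding group_of_def using assms by (intro the_equality) (auto dest: partition_onD2 disjointD)

lemma group_of_subset:
  assumes "partition_on V P" "u \<in> V"
  shows "group_of P u \<subseteq> V"
proof -
  obtain X where X: "X \<in> P" "u \<in> X"
    using assms by (auto dest: partition_onD1)
  moreover have "X \<subseteq> V"
    using X assms(1) by (auto dest: partition_onD1)
  ultimately show ?thesis
    using group_of_eq[OF assms(1)] by simp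
qed

text \<open>\<open>move\<close> removes S from every group other than the target, so
  \<open>X \<union> S\<close> is the only set left that can contain u.\<close>

lemma group_of_move:
  assumes "u \<in> S"
  shows "group_of (move P S X) u = X \<union> S"
  unfolding group_of_def move_def using assms by (intro the_equality) auto

lemma k_stable_founding:
  assumes "k_stable V w k P" "S \<subseteq> V" "S \<noteq> {}" "card S \<le> k"
  shows "\<exists>u\<in>S. (\<Sum>v\<in>S - {u}. w u v) \<le> utility w P u"
proof (rule ccontr)
  assume "\<not> ?thesis"
  \<comment> \<open>The empty group is always an admissible target. Only the utility after the move
    is unfolded; the one in P stays symbolic.\<close>
  then have "k_deviation V w k P S {}"
    using assms by (auto simp: k_deviation_def utility_def[of _ "move _ _ _"] group_of_move not_le)
  with assms(1) show False
    by (auto simp: k_stable_def)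
qed

lemma k_stable_utility_nonneg:
  assumes "k_stable V w k P" "k \<ge> 1" "u \<in> V"
  shows "0 \<le> utility w P u"
  using k_stable_founding[OF assms(1), of "{u}"] assms by simp

context coloring_game
begin

lemma weight_neq_PInf:
  assumes "u \<in> V" "v \<in> V" "u \<noteq> v"
  shows "w u v \<noteq> \<infinity>"
  using weight[OF assms] weight_set by auto

lemma mem_pos_neighbours_sym:
  assumes "u \<in> V" "v \<in> V"
  shows "v \<in> pos_neighbours V w u \<longleftrightarrow> u \<in> pos_neighbours V w v"
  using assms symmetric[of u v] by (auto simp: pos_neighbours_def)

lemma utility_neq_PInf:
  assumes "partition_on V P" "u \<in> V"
  shows "utility w P u \<noteq> \<infinity>"
  unfolding utility_def sum_Pinfty
  using group_of_subset[OF assms] weight_neq_PInf assms(2) by auto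

text \<open>Clipping the weights at 0 makes the sum monotone in its index set. The resulting bound
  does not depend on P, so it applies to an optimal partition.\<close>

lemma utility_le_pos_neighbours:
  assumes "partition_on V P" "u \<in> V"
  shows "utility w P u \<le> (\<Sum>v\<in>pos_neighbours V w u. w u v)"
proof -
  have sub: "group_of P u - {u} \<subseteq> V - {u}"
    using group_of_subset[OF assms] by auto
  have "utility w P u \<le> (\<Sum>v\<in>group_of P u - {u}. max (w u v) 0)"
    unfolding utility_def by (intro sum_mono) simp
  also have "\<dots> \<le> (\<Sum>v\<in>V - {u}. max (w u v) 0)"
    using sub finite_players by (intro sum_mono2) auto
  also have "\<dots> = (\<Sum>v\<in>pos_neighbours V w u. max (w u v) 0)"
    using finite_players assms(2) symmetric[of u]
    by (intro sum.mono_neutral_right) (auto simp: pos_neighbours_def max_def)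
  also have "\<dots> = (\<Sum>v\<in>pos_neighbours V w u. w u v)"
    using assms(2) symmetric[of u]
    by (intro sum.cong) (auto simp: pos_neighbours_def max_def)
  finally show ?thesis .
qed

text \<open>The sum replaces the maximum of the two utilities, at no loss of validity since both are
  nonnegative, because a sum can be double counted.\<close>

lemma weight_le_utility_sum:
  assumes "k_stable V w k P" "k \<ge> 2" "u \<in> V" "v \<in> V" "u \<noteq> v"
  shows "w u v \<le> utility w P u + utility w P v"
proof -
  have "w u v \<le> utility w P u \<or> w v u \<le> utility w P v"
    using k_stable_founding[OF assms(1), of "{u, v}"] assms by (auto simp: insert_Diff_if)
  then have *: "w u v \<le> utility w P u \<or> w u v \<le> utility w P v"
    using symmetric assms by simp
  have "0 \<le> utility w P u" "0 \<le> utility w P v"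
    using k_stable_utility_nonneg[OF assms(1)] assms by auto
  with * show ?thesis
    by (auto intro: order_trans simp: add_increasing add_increasing2)
qed

text \<open>Stability excludes -\<infinity> and the weights exclude \<infinity>, so the counting can
  be done in the reals, where the arithmetic is unrestricted.\<close>

lemma k_stable_utility_real:
  assumes "k_stable V w k P" "k \<ge> 1"
  obtains g where "\<And>u. u \<in> V \<Longrightarrow> utility w P u = ereal (g u)" "\<And>u. u \<in> V \<Longrightarrow> 0 \<le> g u"
proof (rule that[of "\<lambda>u. real_of_ereal (utility w P u)"])
  fix u assume u: "u \<in> V"
  have nonneg: "0 \<le> utility w P u"
    using k_stable_utility_nonneg[OF assms u] .
  moreover have "utility w P u \<noteq> \<infinity>"
    using utility_neq_PInf[OF _ u] assms(1) by (simp add: k_stable_def)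
  ultimately show "utility w P u = ereal (real_of_ereal (utility w P u))"
    by (cases "utility w P u") simp_all
  show "0 \<le> real_of_ereal (utility w P u)"
    using nonneg by (rule real_of_ereal_pos)
qed

text \<open>Double counting: the neighbour relation is symmetric, so exchanging the sums shows that
  the \<open>g v\<close> half equals the \<open>g u\<close> half, and in each half a player is
  counted once per neighbour.\<close>

lemma sum_pos_neighbours_le:
  fixes g :: "'a \<Rightarrow> real"
  assumes "\<And>u. u \<in> V \<Longrightarrow> 0 \<le> g u"
  shows "(\<Sum>u\<in>V. \<Sum>v\<in>pos_neighbours V w u. g u + g v)
    \<le> 2 * real (max_pos_degree V w) * (\<Sum>u\<in>V. g u)"
proof -
  have "(\<Sum>u\<in>V. \<Sum>v\<in>pos_neighbours V w u. g v)
      = (\<Sum>u\<in>V. \<Sum>v\<in>{v \<in> V. v \<in> pos_neighbours V w u}. g v)"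
    by (intro sum.cong) (auto simp: pos_neighbours_def)
  also have "\<dots> = (\<Sum>v\<in>V. \<Sum>u\<in>{u \<in> V. v \<in> pos_neighbours V w u}. g v)"
    using finite_players by (rule sum.swap_restrict) (rule finite_players)
  also have "\<dots> = (\<Sum>v\<in>V. \<Sum>u\<in>pos_neighbours V w v. g v)"
    using mem_pos_neighbours_sym by (intro sum.cong) (auto simp: pos_neighbours_def)
  finally have "(\<Sum>u\<in>V. \<Sum>v\<in>pos_neighbours V w u. g u + g v)
      = 2 * (\<Sum>u\<in>V. real (card (pos_neighbours V w u)) * g u)"
    by (simp add: sum.distrib)
  also have "\<dots> \<le> 2 * (\<Sum>u\<in>V. real (max_pos_degree V w) * g u)"
    \<comment> \<open>Raising the coefficient from the degree of u to the maximum degree relies on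
      \<open>g u\<close> being nonnegative.\<close>
    using card_pos_neighbours_le[OF finite_players] assms
    by (intro mult_left_mono sum_mono mult_right_mono) auto
  finally show ?thesis
    by (simp add: sum_distrib_left mult.assoc)
qed

text \<open>The product form stays meaningful when the stable partition has global utility 0; the
  quotient is formed only afterwards.\<close>

lemma global_utility_le_k_stable:
  assumes "partition_on V Q" "k_stable V w k P" "k \<ge> 2"
  shows "global_utility V w Q \<le> ereal (2 * real (max_pos_degree V w)) * global_utility V w P"
proof -
  obtain g where g: "\<And>u. u \<in> V \<Longrightarrow> utility w P u = ereal (g u)" "\<And>u. u \<in> V \<Longrightarrow> 0 \<le> g u"
    using k_stable_utility_real[OF assms(2)] assms(3) by auto
  have "global_utility V w Q \<le> (\<Sum>u\<in>V. \<Sum>v\<in>pos_neighbours V w u. w u v)"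
    unfolding global_utility_def using utility_le_pos_neighbours[OF assms(1)] by (rule sum_mono)
  also have "\<dots> \<le> (\<Sum>u\<in>V. \<Sum>v\<in>pos_neighbours V w u. ereal (g u + g v))"
  proof (intro sum_mono)
    fix u v assume "u \<in> V" "v \<in> pos_neighbours V w u"
    then show "w u v \<le> ereal (g u + g v)"
      using weight_le_utility_sum[OF assms(2,3), of u v] g by (auto simp: pos_neighbours_def)
  qed
  also have "\<dots> = ereal (\<Sum>u\<in>V. \<Sum>v\<in>pos_neighbours V w u. g u + g v)"
    by simp
  also have "\<dots> \<le> ereal (2 * real (max_pos_degree V w) * (\<Sum>u\<in>V. g u))"
    using sum_pos_neighbours_le[OF g(2)] by simp
  also have "\<dots> = ereal (2 * real (max_pos_degree V w)) * global_utility V w P"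
    using g(1) by (simp add: global_utility_def)
  finally show ?thesis .
qed

lemma global_utility_ratio_le:
  assumes "partition_on V Q" "global_utility V w P \<le> global_utility V w Q"
    and "k_stable V w k P" "k \<ge> 2"
  shows "global_utility V w Q / global_utility V w P \<le> ereal (2 * real (max_pos_degree V w))"
proof -
  obtain g where g: "\<And>u. u \<in> V \<Longrightarrow> utility w P u = ereal (g u)" "\<And>u. u \<in> V \<Longrightarrow> 0 \<le> g u"
    using k_stable_utility_real[OF assms(3)] assms(4) by auto
  have P: "global_utility V w P = ereal (sum g V)"
    using g(1) by (simp add: global_utility_def)
  have nonneg: "0 \<le> sum g V"
    using g(2) by (rule sum_nonneg)
  note le = global_utility_le_k_stable[OF assms(1,3,4)]
  show ?thesis
  proof (cases "sum g V = 0")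
    \<comment> \<open>A positive numerator over 0 would give \<infinity>, but the product bound
      forces the numerator to be 0 as well, and 0 / 0 = 0. This case includes empty V, where
      \<open>Max\<close> is taken of the empty set but the bound is still nonnegative.\<close>
    case True
    then have "global_utility V w P = 0"
      using P by simp
    then have "global_utility V w Q = 0"
      using le assms(2) by (intro antisym) simp_all
    then show ?thesis
      by simp
  next
    case False
    then have "0 < sum g V"
      using nonneg by simp
    then show ?thesis
      unfolding P using le[unfolded P] by (subst ereal_divide_le_pos) (simp_all add: mult.commute)
  qed
qed

end

theorem theorem12:
  "\<exists>C::real. C > 0 \<and>
     (\<forall>(W :: ereal set) (k :: nat) (V :: 'a set) (w :: 'a \<Rightarrow> 'a \<Rightarrow> ereal)
        (P_max :: 'a set set) (P_min :: 'a set set).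
        k \<ge> 2 \<longrightarrow>
        coloring_game W V w \<longrightarrow>
        (\<exists>P. k_stable V w k P) \<longrightarrow>
        is_arg_max (global_utility V w) (partition_on V) P_max \<longrightarrow>
        is_arg_min (global_utility V w) (k_stable V w k) P_min \<longrightarrow>
        global_utility V w P_max / global_utility V w P_min
          \<le> ereal (C * real (max_pos_degree V w)))"
\<comment> \<open>The constant 2 stands for the two endpoints whose utilities bound the weight of a
  pair.\<close>
proof (rule exI[of _ 2], intro conjI allI impI)
  fix W :: "ereal set" and k :: nat and V :: "'a set" and w :: "'a \<Rightarrow> 'a \<Rightarrow> ereal"
    and P_max P_min :: "'a set set"
  assume "k \<ge> 2" and game: "coloring_game W V w"
    and opt: "is_arg_max (global_utility V w) (partition_on V) P_max"
    and worst: "is_arg_min (global_utility V w) (k_stable V w k) P_min"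
  have stable: "k_stable V w k P_min"
    using worst by (simp add: is_arg_min_def)
  \<comment> \<open>A stable partition is in particular a partition, so it competes with the
    optimum.\<close>
  then have "global_utility V w P_min \<le> global_utility V w P_max"
    using opt by (auto simp: is_arg_max_def k_stable_def not_less)
  moreover have "partition_on V P_max"
    using opt by (simp add: is_arg_max_def)
  ultimately show "global_utility V w P_max / global_utility V w P_min
      \<le> ereal (2 * real (max_pos_degree V w))"
    using coloring_game.global_utility_ratio_le[OF game] stable \<open>k \<ge> 2\<close> by blast
qed simp

end
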